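(* For every $k\ge1$ and every rainbow pre-coloring tuple $(H, \psi)$ with colors in $[k]$, $$\pi_k^{\ast}(H, \psi) = \pi_k^{\ast}(\{\text{all color homomorphic images of }(H, \psi)\}).$$
   Context: Multigraphs have no loops. For a multigraph $H$ and distinct $u,v$, $E(H)_{uv}$ is the set of edges between $u$ and $v$. A pre-coloring of $H$ is a map $\psi:X\to[k]$, $X=\mathbf{dom}(\psi)\subseteq E(H)$, injective on $E(H)_{uv}\cap X$ for each pair; it is rainbow if injective on $X$. For pre-coloring tuples $(H,\psi_1),(G,\psi_2)$, a color homomorphism is a pair $(f,\tilde f)$ where $f:V(H)\to V(G)$ maps adjacent vertices to adjacent vertices, $\tilde f:E(H)\to E(G)$ is injective with $\tilde f(E(H)_{uv})\subseteq E(G)_{f(u)f(v)}$, $\mathbf{dom}(\psi_2)=\tilde f(\mathbf{dom}(\psi_1))$, and $\psi_1(e)=\psi_2(\tilde f(e))$ for $e\in\mathbf{dom}(\psi_1)$; $(G,\psi_2)$ is a color homomorphic image of $(H,\psi_1)$ if such exists with $\tilde f$ bijective. A graph system of order $k$ on $V$ is a tuple of simple graphs $(G_1,\dots,G_k)$ on $V$; it is rainbow $(F,\rho)$-free if there is no multigraph $F'$ with $V(F')\subseteq V$, isomorphism $\phi:F\to F'$ and injective $\rho':E(F')\to[k]$ with $\rho'\circ\phi$ extending $\rho$ and $e\in E(G_{\rho'(e)})$ for all $e$; it is rainbow $\mathcal{F}$-free for a family $\mathcal{F}$ if it is rainbow $(F,\rho)$-free for all $(F,\rho)\in\mathcal{F}$.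 $\mathrm{ex}_k^*(n,\mathcal{F})$ is the maximum of $\min_i|E(G_i)|$ over rainbow $\mathcal{F}$-free graph systems of order $k$ on $[n]$, and $\pi_k^*(\mathcal{F})=\lim_{n\to\infty}\mathrm{ex}_k^*(n,\mathcal{F})/\binom{n}{2}$; $\pi_k^*(H,\psi)=\pi_k^*(\{(H,\psi)\})$. *)

theory Defs
  imports Complex_Main "HOL-Library.FuncSet" "HOL-Library.Ramsey"
begin

record ('v, 'e) multigraph =
  verts :: "'v set"
  edges :: "'e set"
  ends :: "'e \<Rightarrow> 'v set"

definition multigraph :: "('v, 'e) multigraph \<Rightarrow> bool" where
  "multigraph H \<longleftrightarrow> finite (verts H) \<and> finite (edges H) \<and>
     (\<forall>e\<in>edges H. \<exists>u\<in>verts H. \<exists>v\<in>verts H. u \<noteq> v \<and> ends H e = {u, v})"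

definition edges_between :: "('v, 'e) multigraph \<Rightarrow> 'v \<Rightarrow> 'v \<Rightarrow> 'e set" where
  "edges_between H u v = {e \<in> edges H. ends H e = {u, v}}"

definition adjacent :: "('v, 'e) multigraph \<Rightarrow> 'v \<Rightarrow> 'v \<Rightarrow> bool" where
  "adjacent H u v \<longleftrightarrow> u \<noteq> v \<and> edges_between H u v \<noteq> {}"

text \<open>Colours are the elements of \<open>{1..k}\<close>; a pre-colouring is a partial map on edges.\<close>

definition precoloring_tuple :: "nat \<Rightarrow> ('v, 'e) multigraph \<Rightarrow> ('e \<rightharpoonup> nat) \<Rightarrow> bool" where
  "precoloring_tuple k H \<psi> \<longleftrightarrow> multigraph H \<and> dom \<psi> \<subseteq> edges H \<and> ran \<psi> \<subseteq> {1..k} \<and>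
     (\<forall>u\<in>verts H. \<forall>v\<in>verts H. u \<noteq> v \<longrightarrow> inj_on \<psi> (edges_between H u v \<inter> dom \<psi>))"

definition rainbow_tuple :: "nat \<Rightarrow> ('v, 'e) multigraph \<Rightarrow> ('e \<rightharpoonup> nat) \<Rightarrow> bool" where
  "rainbow_tuple k H \<psi> \<longleftrightarrow> precoloring_tuple k H \<psi> \<and> inj_on \<psi> (dom \<psi>)"

definition color_hom ::
  "('v, 'e) multigraph \<Rightarrow> ('e \<rightharpoonup> nat) \<Rightarrow> ('w, 'd) multigraph \<Rightarrow> ('d \<rightharpoonup> nat) \<Rightarrow>
   ('v \<Rightarrow> 'w) \<Rightarrow> ('e \<Rightarrow> 'd) \<Rightarrow> bool" where
  "color_hom H \<psi>\<^sub>1 G \<psi>\<^sub>2 f g \<longleftrightarrow>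
     f \<in> verts H \<rightarrow> verts G \<and>
     (\<forall>u\<in>verts H. \<forall>v\<in>verts H. adjacent H u v \<longrightarrow> adjacent G (f u) (f v)) \<and>
     g \<in> edges H \<rightarrow> edges G \<and> inj_on g (edges H) \<and>
     (\<forall>u\<in>verts H. \<forall>v\<in>verts H. u \<noteq> v \<longrightarrow>
        g ` edges_between H u v \<subseteq> edges_between G (f u) (f v)) \<and>
     dom \<psi>\<^sub>2 = g ` dom \<psi>\<^sub>1 \<and>
     (\<forall>e\<in>dom \<psi>\<^sub>1. \<psi>\<^sub>1 e = \<psi>\<^sub>2 (g e))"

text \<open>Only the edge map has to be bijective, so an image may contain vertices outside the range
  of the vertex map.\<close>

definition color_hom_image ::
  "('v, 'e) multigraph \<Rightarrow> ('e \<rightharpoonup> nat) \<Rightarrow> ('w, 'd) multigraph \<Rightarrow> ('d \<rightharpoonup> nat) \<Rightarrow> bool" where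
  "color_hom_image H \<psi>\<^sub>1 G \<psi>\<^sub>2 \<longleftrightarrow>
     (\<exists>f g. color_hom H \<psi>\<^sub>1 G \<psi>\<^sub>2 f g \<and> bij_betw g (edges H) (edges G))"

text \<open>Since multigraphs are finite, every colour homomorphic image is isomorphic to one whose
  vertices and edges are natural numbers; these represent the family of all images.\<close>

definition color_hom_images ::
  "nat \<Rightarrow> ('v, 'e) multigraph \<Rightarrow> ('e \<rightharpoonup> nat) \<Rightarrow> ((nat, nat) multigraph \<times> (nat \<rightharpoonup> nat)) set" where
  "color_hom_images k H \<psi> =
     {(G, \<psi>'). precoloring_tuple k G \<psi>' \<and> color_hom_image H \<psi> G \<psi>'}"

text \<open>A simple graph on \<open>V\<close> is given by its edge set, a set of two-element subsets of \<open>V\<close>;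
  only the indices \<open>1, \<dots>, k\<close> of \<open>G\<close> are relevant.\<close>

definition graph_system :: "nat \<Rightarrow> 'v set \<Rightarrow> (nat \<Rightarrow> 'v set set) \<Rightarrow> bool" where
  "graph_system k V G \<longleftrightarrow> (\<forall>i\<in>{1..k}. G i \<subseteq> nsets V 2)"

definition multigraph_iso ::
  "('v, 'e) multigraph \<Rightarrow> ('w, 'd) multigraph \<Rightarrow> ('v \<Rightarrow> 'w) \<Rightarrow> ('e \<Rightarrow> 'd) \<Rightarrow> bool" where
  "multigraph_iso F F' \<phi> \<phi>' \<longleftrightarrow>
     bij_betw \<phi> (verts F) (verts F') \<and> bij_betw \<phi>' (edges F) (edges F') \<and>
     (\<forall>e\<in>edges F. ends F' (\<phi>' e) = \<phi> ` ends F e)"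

text \<open>The edges of the copy \<open>F'\<close> are abstract labels, so they can be taken in the edge type of \<open>F\<close>.\<close>

definition rainbow_free ::
  "nat \<Rightarrow> 'w set \<Rightarrow> (nat \<Rightarrow> 'w set set) \<Rightarrow> ('v, 'e) multigraph \<Rightarrow> ('e \<rightharpoonup> nat) \<Rightarrow> bool" where
  "rainbow_free k V G F \<rho> \<longleftrightarrow>
     \<not> (\<exists>(F' :: ('w, 'e) multigraph) \<phi> \<phi>' \<rho>'.
          multigraph F' \<and> verts F' \<subseteq> V \<and> multigraph_iso F F' \<phi> \<phi>' \<and>
          \<rho>' \<in> edges F' \<rightarrow> {1..k} \<and> inj_on \<rho>' (edges F') \<and>
          (\<forall>e\<in>dom \<rho>. \<rho> e = Some (\<rho>' (\<phi>' e))) \<and>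
          (\<forall>e\<in>edges F'. ends F' e \<in> G (\<rho>' e)))"

definition rainbow_family_free ::
  "nat \<Rightarrow> 'w set \<Rightarrow> (nat \<Rightarrow> 'w set set) \<Rightarrow> (('v, 'e) multigraph \<times> ('e \<rightharpoonup> nat)) set \<Rightarrow> bool" where
  "rainbow_family_free k V G \<F> \<longleftrightarrow> (\<forall>(F, \<rho>)\<in>\<F>. rainbow_free k V G F \<rho>)"

text \<open>The set below is finite, so its supremum is its maximum; if no graph system is
  \<open>\<F>\<close>-free (which happens for edgeless members of \<open>\<F>\<close>), the value is \<open>0\<close>.\<close>

definition ex_star :: "nat \<Rightarrow> nat \<Rightarrow> (('v, 'e) multigraph \<times> ('e \<rightharpoonup> nat)) set \<Rightarrow> nat" where
  "ex_star k n \<F> =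
     Sup {Min ((\<lambda>i. card (G i)) ` {1..k}) | G.
            graph_system k {1..n} G \<and> rainbow_family_free k {1..n} G \<F>}"

definition ex_star_density ::
  "nat \<Rightarrow> (('v, 'e) multigraph \<times> ('e \<rightharpoonup> nat)) set \<Rightarrow> nat \<Rightarrow> real" where
  "ex_star_density k \<F> n = real (ex_star k n \<F>) / real (n choose 2)"

definition pi_star :: "nat \<Rightarrow> (('v, 'e) multigraph \<times> ('e \<rightharpoonup> nat)) set \<Rightarrow> real" where
  "pi_star k \<F> = lim (ex_star_density k \<F>)"

end

theory Submission
  imports Defs
begin

text \<open>
  A graph system avoids all colour homomorphic images of \<open>(H, \<psi>)\<close> iff it admits no rainbow
  homomorphism from \<open>(H, \<psi>)\<close> at all, and it avoids \<open>(H, \<psi>)\<close> iff it admits no injective one.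
  Given an \<open>(H, \<psi>)\<close>-free system \<open>G\<close> on a large vertex set \<open>A\<close>, pull it back along a uniformly random
  map \<open>y\<close> from a fixed set \<open>I\<close> to \<open>A\<close>. The values of \<open>y\<close> are independent, so by the second moment
  method all edge densities are nearly preserved. For fixed \<open>x : V(H) \<rightarrow> I\<close> let \<open>p(x)\<close> be the
  probability that \<open>y \<circ> x\<close> is a homomorphism with a fixed colouring. If \<open>x\<close> is injective, then
  \<open>p(x)\<close> is at most the probability of a collision, which is \<open>O(1/|A|)\<close>. If \<open>x\<close> identifies two
  vertices, sending one of them to a fresh point gives \<open>x'\<close> with \<open>p(x)\<^sup>2 \<le> p(x')\<close> by Cauchy-Schwarz.
  Hence all \<open>p(x)\<close> tend to 0, and some pullback is free of all images. This bounds the density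
  of \<open>(H, \<psi>)\<close> at every large \<open>n\<close> by the density of the family at \<open>m = |I|\<close> up to an error
  small in \<open>m\<close>, which gives both the convergence and the equality of the limits.
\<close>

section \<open>Averages over finite sets and second moments\<close>

text \<open>Expectation under the uniform distribution on \<open>S\<close>. For empty or infinite
  \<open>S\<close> the quotient is 0, so linearity and monotonicity hold without side
  conditions.\<close>

definition mean :: "'a set \<Rightarrow> ('a \<Rightarrow> real) \<Rightarrow> real" where
  "mean S f = (\<Sum>x\<in>S. f x) / real (card S)"

lemma mean_mono: "(\<And>x. x \<in> S \<Longrightarrow> f x \<le> g x) \<Longrightarrow> mean S f \<le> mean S g"
  by (simp add: mean_def divide_right_mono sum_mono)

lemma mean_cong: "(\<And>x. x \<in> S \<Longrightarrow> f x = g x) \<Longrightarrow> mean S f = mean S g"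
  by (simp add: mean_def)

lemma mean_nonneg: "(\<And>x. x \<in> S \<Longrightarrow> 0 \<le> f x) \<Longrightarrow> 0 \<le> mean S f"
  by (simp add: mean_def sum_nonneg)

lemma mean_const: "finite S \<Longrightarrow> S \<noteq> {} \<Longrightarrow> mean S (\<lambda>_. c) = c"
  by (simp add: mean_def)

lemma mean_sum: "mean S (\<lambda>x. \<Sum>i\<in>T. f i x) = (\<Sum>i\<in>T. mean S (f i))"
  unfolding mean_def by (subst sum.swap) (simp add: sum_divide_distrib)

lemma mean_add: "mean S (\<lambda>x. f x + g x) = mean S f + mean S g"
  by (simp add: mean_def sum.distrib add_divide_distrib)

lemma mean_mult_left: "mean S (\<lambda>x. c * f x) = c * mean S f"
  by (simp add: mean_def sum_distrib_left)

lemma mean_mult_right: "mean S (\<lambda>x. f x * c) = mean S f * c"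
  by (simp add: mean_def sum_distrib_right)

lemma mean_divide: "mean S (\<lambda>x. f x / c) = mean S f / c"
  using mean_mult_right[of S f "1 / c"] by simp

text \<open>Nonnegativity of the variance; this is the form of Cauchy-Schwarz used for splitting
  identified vertices.\<close>

lemma mean_square:
  assumes "finite S" "S \<noteq> {}"
  shows "(mean S f)\<^sup>2 \<le> mean S (\<lambda>x. (f x)\<^sup>2)"
proof -
  let ?m = "mean S f"
  have "0 \<le> mean S (\<lambda>x. (f x - ?m)\<^sup>2)"
    by (rule mean_nonneg) simp
  also have "\<dots> = mean S (\<lambda>x. ((f x)\<^sup>2 + (- 2 * ?m) * f x) + ?m\<^sup>2)"
    by (rule mean_cong) (simp add: power2_diff)
  also have "\<dots> = mean S (\<lambda>x. (f x)\<^sup>2) + (- 2 * ?m) * ?m + ?m\<^sup>2"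
    by (simp only: mean_add mean_mult_left mean_const[OF assms])
  finally show ?thesis by (simp add: power2_eq_square)
qed

lemma mean_less_imp:
  assumes "finite S" "S \<noteq> {}" "mean S f < c"
  shows "\<exists>x\<in>S. f x < c"
proof (rule ccontr)
  assume "\<not> ?thesis"
  then have "mean S (\<lambda>_. c) \<le> mean S f" by (intro mean_mono) auto
  with assms show False by (simp add: mean_const)
qed

lemma mean_of_bool_le_1: "mean S (\<lambda>x. of_bool (P x)) \<le> 1"
proof (cases "finite S \<and> S \<noteq> {}")
  case True
  then have "mean S (\<lambda>x. of_bool (P x)) \<le> mean S (\<lambda>_. 1)" by (intro mean_mono) auto
  with True show ?thesis by (simp add: mean_const)
qed (auto simp: mean_def)

text \<open>Resampling one coordinate preserves the uniform distribution, because
  \<open>(y, s) \<mapsto> (y(a := s), y a)\<close> is an involution. This is the only form of independence used below.\<close>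

lemma mean_resample:
  assumes "finite I" "finite A" "A \<noteq> {}" "a \<in> I"
  shows "mean (I \<rightarrow>\<^sub>E A) f = mean (I \<rightarrow>\<^sub>E A) (\<lambda>y. mean A (\<lambda>s. f (y(a := s))))"
proof -
  let ?W = "I \<rightarrow>\<^sub>E A"
  have "(\<Sum>y\<in>?W. \<Sum>s\<in>A. f (y(a := s))) = (\<Sum>(y, s)\<in>?W \<times> A. f (y(a := s)))"
    by (simp add: sum.cartesian_product)
  also have "\<dots> = (\<Sum>(y, s)\<in>?W \<times> A. f y)"
    using \<open>a \<in> I\<close>
    by (intro sum.reindex_bij_witness[where i = "\<lambda>(y, s). (y(a := s), y a)"
          and j = "\<lambda>(y, s). (y(a := s), y a)"])
      (auto simp: PiE_def Pi_def extensional_def)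
  also have "\<dots> = real (card A) * (\<Sum>y\<in>?W. f y)"
    by (simp flip: sum.cartesian_product add: sum_distrib_left)
  finally show ?thesis
    using assms by (simp add: mean_def flip: sum_divide_distrib)
qed

text \<open>Expand the square into products indexed by two pairs \<open>q\<close>, \<open>r\<close>
  of \<open>D\<close>. If they share no coordinate, independence and the zero total of
  \<open>g\<close> make the expected product vanish; otherwise it is at most 1. Each of the at most
  \<open>card I ^ 2\<close> pairs meets at most \<open>4 * card I\<close> others, itself
  included.\<close>

lemma mean_pair_square:
  fixes g :: "'a \<Rightarrow> 'a \<Rightarrow> real"
  assumes I: "finite I" and A: "finite A" "A \<noteq> {}"
    and g0: "(\<Sum>s\<in>A. \<Sum>t\<in>A. g s t) = 0"
    and g1: "\<And>s t. s \<in> A \<Longrightarrow> t \<in> A \<Longrightarrow> \<bar>g s t\<bar> \<le> 1"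
    and D: "D \<subseteq> I \<times> I" "\<And>a b. (a, b) \<in> D \<Longrightarrow> a \<noteq> b"
  shows "mean (I \<rightarrow>\<^sub>E A) (\<lambda>y. (\<Sum>(a, b)\<in>D. g (y a) (y b))\<^sup>2) \<le> 4 * real (card I) ^ 3"
proof -
  let ?W = "I \<rightarrow>\<^sub>E A"
  let ?meet = "\<lambda>q r. fst r = fst q \<or> fst r = snd q \<or> snd r = fst q \<or> snd r = snd q"
  let ?h = "\<lambda>q y. g (y (fst q)) (y (snd q))"
  have W: "finite ?W" "?W \<noteq> {}" using I A by (auto simp: finite_PiE PiE_eq_empty_iff)
  have finD: "finite D" using D(1) I finite_subset by blast
  have prod: "mean ?W (\<lambda>y. ?h q y * ?h r y) \<le> of_bool (?meet q r)" if q: "q \<in> D" and r: "r \<in> D" for q r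
  proof (cases "?meet q r")
    case True
    have "mean ?W (\<lambda>y. ?h q y * ?h r y) \<le> mean ?W (\<lambda>_. 1)"
    proof (rule mean_mono)
      fix y assume y: "y \<in> ?W"
      have "\<bar>?h q y\<bar> \<le> 1" "\<bar>?h r y\<bar> \<le> 1"
        using subsetD[OF D(1) q] subsetD[OF D(1) r]
        by (auto intro!: g1 PiE_mem[OF y] simp: mem_Times_iff)
      then have "\<bar>?h q y * ?h r y\<bar> \<le> 1" by (simp add: abs_mult mult_le_one)
      then show "?h q y * ?h r y \<le> 1" by linarith
    qed
    with True W show ?thesis by (simp add: mean_const)
  next
    case False
    obtain a b where ab: "q = (a, b)" "a \<in> I" "b \<in> I" "a \<noteq> b" using q D by (cases q) auto
    \<comment> \<open>Both coordinates of \<open>q\<close> are resampled. They do not occur in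
      \<open>r\<close>, so the second factor stays fixed while the first averages to 0.\<close>
    have "mean ?W (\<lambda>y. ?h q y * ?h r y)
      = mean ?W (\<lambda>y. mean A (\<lambda>s. mean A (\<lambda>t. ?h q (y(a := s, b := t)) * ?h r (y(a := s, b := t)))))"
      using I A ab by (subst mean_resample[where a = b], simp_all, subst mean_resample[where a = a]) simp_all
    also have "\<dots> = mean ?W (\<lambda>y. mean A (\<lambda>s. mean A (\<lambda>t. g s t)) * ?h r y)"
      using ab False by (auto simp: mean_mult_right intro!: mean_cong)
    also have "mean A (\<lambda>s. mean A (\<lambda>t. g s t)) = 0"
      using g0 by (simp add: mean_def flip: sum_divide_distrib)
    also have "mean ?W (\<lambda>y. 0 * ?h r y) = 0"
      by (simp add: mean_def)
    finally have "mean ?W (\<lambda>y. ?h q y * ?h r y) = 0" .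
    then show ?thesis by (simp only: of_bool_def split: if_split) simp
  qed
  have count: "(\<Sum>r\<in>D. of_bool (?meet q r)) \<le> 4 * real (card I)" if q: "q \<in> D" for q
  proof -
    have "{r \<in> D. ?meet q r} \<subseteq> {fst q, snd q} \<times> I \<union> I \<times> {fst q, snd q}"
      using D(1) by (auto simp: subset_iff)
    then have "card {r \<in> D. ?meet q r} \<le> card ({fst q, snd q} \<times> I \<union> I \<times> {fst q, snd q})"
      using I by (intro card_mono) auto
    also have "\<dots> \<le> card ({fst q, snd q} \<times> I) + card (I \<times> {fst q, snd q})"
      by (rule card_Un_le)
    also have "\<dots> \<le> 4 * card I"
      by (simp add: card_cartesian_product card_insert_if)
    finally have "real (card {r \<in> D. ?meet q r}) \<le> real (4 * card I)" by (simp only: of_nat_le_iff)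
    moreover have "(\<Sum>r\<in>D. of_bool (?meet q r)) = real (card {r \<in> D. ?meet q r})"
      using finD by (subst sum_of_bool_eq) (auto intro!: arg_cong[where f = card])
    ultimately show ?thesis by linarith
  qed
  have "(\<lambda>y. (\<Sum>(a, b)\<in>D. g (y a) (y b))\<^sup>2) = (\<lambda>y. \<Sum>q\<in>D. \<Sum>r\<in>D. ?h q y * ?h r y)"
    by (auto simp: power2_eq_square sum_product case_prod_unfold)
  then have "mean ?W (\<lambda>y. (\<Sum>(a, b)\<in>D. g (y a) (y b))\<^sup>2) = (\<Sum>q\<in>D. \<Sum>r\<in>D. mean ?W (\<lambda>y. ?h q y * ?h r y))"
    by (simp add: mean_sum)
  also have "\<dots> \<le> (\<Sum>q\<in>D. \<Sum>r\<in>D. of_bool (?meet q r))"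
    by (intro sum_mono prod)
  also have "\<dots> \<le> (\<Sum>q\<in>D. 4 * real (card I))"
    by (intro sum_mono count)
  also have "\<dots> = real (card D) * (4 * real (card I))" by simp
  also have "\<dots> \<le> real (card I * card I) * (4 * real (card I))"
    using card_mono[OF _ D(1)] I by (intro mult_right_mono) (simp_all only: of_nat_le_iff card_cartesian_product finite_cartesian_product)
  finally show ?thesis by (simp add: power3_eq_cube)
qed

text \<open>Double counting: an edge \<open>{u, v}\<close> arises from \<open>(u, v)\<close> and
  \<open>(v, u)\<close>, and the diagonal contributes nothing because edges have two
  elements.\<close>

lemma sum_ordered_pairs:
  assumes "finite A" "G \<subseteq> nsets A 2"
  shows "(\<Sum>s\<in>A. \<Sum>t\<in>A. of_bool ({s, t} \<in> G)) = 2 * real (card G)"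
proof -
  have finG: "finite G" using assms finite_imp_finite_nsets finite_subset by blast
  have "(\<Sum>s\<in>A. \<Sum>t\<in>A. of_bool ({s, t} \<in> G)) = (\<Sum>p\<in>A \<times> A. of_bool ({fst p, snd p} \<in> G) :: real)"
    by (simp add: sum.cartesian_product case_prod_unfold)
  also have "\<dots> = (\<Sum>p\<in>A \<times> A. \<Sum>e\<in>G. of_bool ({fst p, snd p} = e))"
    using finG by (auto simp: of_bool_def intro!: sum.cong)
  also have "\<dots> = (\<Sum>e\<in>G. \<Sum>p\<in>A \<times> A. of_bool ({fst p, snd p} = e))" by (rule sum.swap)
  also have "\<dots> = (\<Sum>e\<in>G. 2)"
  proof (rule sum.cong[OF refl])
    fix e assume "e \<in> G"
    then obtain u v where e: "e = {u, v}" "u \<noteq> v" "u \<in> A" "v \<in> A"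
      using assms(2) by (force simp: nsets_def card_2_iff)
    have "(A \<times> A) \<inter> {p. {fst p, snd p} = e} = {(u, v), (v, u)}"
      using e by (auto simp: doubleton_eq_iff)
    then show "(\<Sum>p\<in>A \<times> A. of_bool ({fst p, snd p} = e)) = (2 :: real)"
      using assms(1) e(2) by (simp add: sum_of_bool_eq)
  qed
  finally show ?thesis by simp
qed

section \<open>Rainbow homomorphisms and freeness\<close>

text \<open>A copy of \<open>H\<close> in the system with the injectivity of the vertex map dropped;
  \<open>c\<close> plays the part of the extended colouring of the copy. If every \<open>G i\<close>
  consists of two-element sets, the last conjunct forces \<open>z\<close> to separate the ends of
  each edge.\<close>

definition rainbow_hom ::
  "nat \<Rightarrow> 'w set \<Rightarrow> (nat \<Rightarrow> 'w set set) \<Rightarrow> ('v, 'e) multigraph \<Rightarrow> ('e \<rightharpoonup> nat) \<Rightarrow>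
   ('v \<Rightarrow> 'w) \<Rightarrow> ('e \<Rightarrow> nat) \<Rightarrow> bool" where
  "rainbow_hom k V G H \<psi> z c \<longleftrightarrow>
     z \<in> verts H \<rightarrow> V \<and> c \<in> edges H \<rightarrow> {1..k} \<and> inj_on c (edges H) \<and>
     (\<forall>e\<in>dom \<psi>. \<psi> e = Some (c e)) \<and> (\<forall>e\<in>edges H. z ` ends H e \<in> G (c e))"

lemma multigraph_endsE:
  assumes "multigraph H" "e \<in> edges H"
  obtains u v where "u \<in> verts H" "v \<in> verts H" "u \<noteq> v" "ends H e = {u, v}"
  using assms unfolding multigraph_def by blast

text \<open>Allows \<open>z\<close> and \<open>c\<close> to be replaced by their restrictions, which
  range over finite sets and can therefore be summed over.\<close>

lemma rainbow_hom_cong: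
  assumes "multigraph H" "dom \<psi> \<subseteq> edges H"
    and "\<And>v. v \<in> verts H \<Longrightarrow> z v = z' v" "\<And>e. e \<in> edges H \<Longrightarrow> c e = c' e"
    and "rainbow_hom k V G H \<psi> z c"
  shows "rainbow_hom k V G H \<psi> z' c'"
proof -
  have "z ` ends H e = z' ` ends H e" if e: "e \<in> edges H" for e
  proof -
    obtain u v where "u \<in> verts H" "v \<in> verts H" "ends H e = {u, v}"
      using multigraph_endsE[OF assms(1) e] .
    then show ?thesis by (simp add: assms(3))
  qed
  then have "z' ` ends H e \<in> G (c' e)" if "e \<in> edges H" for e
    using that assms(4,5) unfolding rainbow_hom_def by simp
  moreover have "z' \<in> verts H \<rightarrow> V" "c' \<in> edges H \<rightarrow> {1..k}"
    using assms(3-5) unfolding rainbow_hom_def Pi_iff by simp_all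
  moreover have "inj_on c' (edges H)"
    using assms(4,5) inj_on_cong[of "edges H" c c'] unfolding rainbow_hom_def by simp
  moreover have "\<psi> e = Some (c' e)" if "e \<in> dom \<psi>" for e
  proof -
    have "e \<in> edges H" using that assms(2) by (rule rev_subsetD)
    then show ?thesis using that assms(4,5) unfolding rainbow_hom_def by simp
  qed
  ultimately show ?thesis unfolding rainbow_hom_def by simp
qed

text \<open>A copy yields the homomorphism made of its vertex isomorphism and its colouring composed
  with the edge isomorphism. Conversely, an injective homomorphism turns its image into a
  copy.\<close>

lemma rainbow_free_iff:
  fixes G :: "nat \<Rightarrow> 'w set set" and F :: "('v, 'e) multigraph"
  assumes F: "multigraph F" and dom: "dom \<rho> \<subseteq> edges F"
  shows "rainbow_free k V G F \<rho> \<longleftrightarrow> \<not> (\<exists>z c. rainbow_hom k V G F \<rho> z c \<and> inj_on z (verts F))"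
proof -
  have "rainbow_hom k V G F \<rho> \<phi> (\<rho>' \<circ> \<phi>') \<and> inj_on \<phi> (verts F)"
    if "verts F' \<subseteq> V" "multigraph_iso F F' \<phi> \<phi>'"
      "\<rho>' \<in> edges F' \<rightarrow> {1..k}" "inj_on \<rho>' (edges F')"
      "\<forall>e\<in>dom \<rho>. \<rho> e = Some (\<rho>' (\<phi>' e))" "\<forall>e\<in>edges F'. ends F' e \<in> G (\<rho>' e)"
    for F' :: "('w, 'e) multigraph" and \<phi> \<phi>' \<rho>'
  proof -
    have b: "bij_betw \<phi> (verts F) (verts F')" "bij_betw \<phi>' (edges F) (edges F')"
      and ends: "\<And>e. e \<in> edges F \<Longrightarrow> ends F' (\<phi>' e) = \<phi> ` ends F e"
      using that(2) by (auto simp: multigraph_iso_def)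
    have im: "\<phi> ` verts F = verts F'" "\<phi>' ` edges F = edges F'" "inj_on \<phi> (verts F)" "inj_on \<phi>' (edges F)"
      using b by (auto simp: bij_betw_def)
    have "\<phi> ` ends F e \<in> G (\<rho>' (\<phi>' e))" if "e \<in> edges F" for e
      using ends[OF that] im(2) that \<open>\<forall>e\<in>edges F'. ends F' e \<in> G (\<rho>' e)\<close> by (metis imageI)
    moreover have "inj_on (\<rho>' \<circ> \<phi>') (edges F)"
      using im that(4) by (intro comp_inj_on) auto
    moreover have "\<phi> \<in> verts F \<rightarrow> V" "\<rho>' \<circ> \<phi>' \<in> edges F \<rightarrow> {1..k}"
      using im that(1,3) by (auto simp only: Pi_iff comp_apply)
    ultimately show ?thesis
      using im(3) that(5) by (simp add: rainbow_hom_def)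
  qed
  moreover have "\<not> rainbow_free k V G F \<rho>" if "rainbow_hom k V G F \<rho> z c" "inj_on z (verts F)" for z c
  proof -
    \<comment> \<open>Edges are abstract labels, so the copy keeps those of \<open>F\<close> and
      only moves their ends; the edge isomorphism is the identity.\<close>
    let ?F = "\<lparr>verts = z ` verts F, edges = edges F, ends = \<lambda>e. z ` ends F e\<rparr>"
    have "\<exists>a\<in>z ` verts F. \<exists>b\<in>z ` verts F. a \<noteq> b \<and> z ` ends F e = {a, b}" if e: "e \<in> edges F" for e
    proof -
      obtain u v where "u \<in> verts F" "v \<in> verts F" "u \<noteq> v" "ends F e = {u, v}"
        using multigraph_endsE[OF F e] .
      then show ?thesis
        using \<open>inj_on z (verts F)\<close> by (intro bexI[of _ "z u"] bexI[of _ "z v"]) (auto dest: inj_onD)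
    qed
    then have "multigraph ?F"
      using F by (simp add: multigraph_def)
    moreover have "multigraph_iso F ?F z id"
      using that by (auto simp: multigraph_iso_def bij_betw_def)
    ultimately show ?thesis
      using that unfolding rainbow_free_def rainbow_hom_def
      by (auto intro!: exI[of _ ?F] exI[of _ z] exI[of _ "id :: 'e \<Rightarrow> 'e"] exI[of _ c])
  qed
  ultimately show ?thesis
    unfolding rainbow_free_def by blast
qed

text \<open>Homomorphisms compose; the colouring stays rainbow because \<open>g\<close> is injective
  on edges.\<close>

lemma rainbow_hom_of_image:
  assumes hom: "rainbow_hom k V G F \<psi>' z c" and F: "color_hom H \<psi> F \<psi>' f g" and H: "multigraph H"
  shows "rainbow_hom k V G H \<psi> (z \<circ> f) (c \<circ> g)"
proof -
  have sub: "g ` edges_between H u v \<subseteq> edges_between F (f u) (f v)"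
    if "u \<in> verts H" "v \<in> verts H" "u \<noteq> v" for u v
    using F that by (simp add: color_hom_def)
  have f: "f \<in> verts H \<rightarrow> verts F" and inj: "inj_on g (edges H)" and dom: "dom \<psi>' = g ` dom \<psi>"
    and \<psi>: "\<And>e. e \<in> dom \<psi> \<Longrightarrow> \<psi> e = \<psi>' (g e)"
    using F by (simp_all add: color_hom_def)
  have z: "z \<in> verts F \<rightarrow> V" and c: "c \<in> edges F \<rightarrow> {1..k}" "inj_on c (edges F)"
    and \<psi>': "\<And>e. e \<in> dom \<psi>' \<Longrightarrow> \<psi>' e = Some (c e)"
    and G: "\<And>e. e \<in> edges F \<Longrightarrow> z ` ends F e \<in> G (c e)"
    using hom by (simp_all add: rainbow_hom_def)
  have g: "g e \<in> edges F" "ends F (g e) = f ` ends H e" if e: "e \<in> edges H" for e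
  proof -
    obtain u v where uv: "u \<in> verts H" "v \<in> verts H" "u \<noteq> v" "ends H e = {u, v}"
      using multigraph_endsE[OF H e] .
    then have "e \<in> edges_between H u v" using e by (simp add: edges_between_def)
    then have "g e \<in> edges_between F (f u) (f v)" using sub[OF uv(1-3)] by blast
    with uv(4) show "g e \<in> edges F" "ends F (g e) = f ` ends H e"
      by (simp_all add: edges_between_def)
  qed
  have "inj_on (c \<circ> g) (edges H)"
    using inj c(2) g(1) by (intro comp_inj_on) (auto intro: inj_on_subset)
  moreover have "\<psi> e = Some ((c \<circ> g) e)" if "e \<in> dom \<psi>" for e
    using \<psi>[OF that] \<psi>'[of "g e"] that dom by simp
  moreover have "(z \<circ> f) ` ends H e \<in> G ((c \<circ> g) e)" if "e \<in> edges H" for e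
    using G[OF g(1)[OF that]] g(2)[OF that] by (simp add: image_comp)
  moreover have "z \<circ> f \<in> verts H \<rightarrow> V" "c \<circ> g \<in> edges H \<rightarrow> {1..k}"
    using f z c(1) g(1) unfolding Pi_iff comp_apply by blast+
  ultimately show ?thesis
    unfolding rainbow_hom_def by blast
qed

text \<open>\<open>F\<close> is the image of \<open>H\<close> under \<open>z\<close>, with parallel
  edges kept distinct. Thus \<open>z\<close> is a colour homomorphism onto \<open>F\<close>, and the
  remaining factor is the inclusion of \<open>F\<close> into the system, which is injective on
  vertices.\<close>

lemma rainbow_hom_factor:
  fixes H :: "('v, 'e) multigraph" and z :: "'v \<Rightarrow> nat"
  assumes H: "rainbow_tuple k H \<psi>" and G: "graph_system k V G"
    and hom: "rainbow_hom k V G H \<psi> z c"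
  obtains F \<psi>' z' c' where "(F, \<psi>') \<in> color_hom_images k H \<psi>"
    "rainbow_hom k V G F \<psi>' z' c'" "inj_on z' (verts F)"
proof -
  have mg: "multigraph H" and dom: "dom \<psi> \<subseteq> edges H" and ran: "ran \<psi> \<subseteq> {1..k}"
    and inj\<psi>: "inj_on \<psi> (dom \<psi>)"
    using H by (auto simp: rainbow_tuple_def precoloring_tuple_def)
  have fin: "finite (verts H)" "finite (edges H)" using mg by (auto simp: multigraph_def)
  \<comment> \<open>Edges are numbered because members of \<open>color_hom_images\<close> have
    natural numbers as edges.\<close>
  obtain g :: "'e \<Rightarrow> nat" where g: "inj_on g (edges H)"
    using finite_imp_inj_to_nat_seg[OF fin(2)] by blast
  define g' where "g' = the_inv_into (edges H) g"
  have g': "\<And>e. e \<in> edges H \<Longrightarrow> g' (g e) = e"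
    using g by (simp add: g'_def the_inv_into_f_f)
  define F where "F = \<lparr>verts = z ` verts H, edges = g ` edges H, ends = \<lambda>j. z ` ends H (g' j)\<rparr>"
  define \<psi>' where "\<psi>' = (\<lambda>j. if j \<in> g ` dom \<psi> then \<psi> (g' j) else None)"
  have endsF: "ends F (g e) = z ` ends H e" if "e \<in> edges H" for e
    using that by (simp add: F_def g')
  have \<psi>'g: "\<psi>' (g e) = \<psi> e" if "e \<in> dom \<psi>" for e
    using that dom by (auto simp: \<psi>'_def g' subset_iff)
  have dom': "dom \<psi>' = g ` dom \<psi>"
  proof
    show "dom \<psi>' \<subseteq> g ` dom \<psi>" by (auto simp: \<psi>'_def split: if_splits)
    show "g ` dom \<psi> \<subseteq> dom \<psi>'" using \<psi>'g by (auto simp: domIff)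
  qed
  \<comment> \<open>\<open>z\<close> collapses no edge: the image would be a singleton, but edges of
    the system have two elements. Hence \<open>F\<close> has no loops.\<close>
  have proper: "z u \<noteq> z v" if "e \<in> edges H" "ends H e = {u, v}" for e u v
  proof
    assume "z u = z v"
    then have "z ` ends H e = {z v}" using that by simp
    moreover have "z ` ends H e \<in> nsets V 2"
      using hom G that(1) unfolding rainbow_hom_def graph_system_def by blast
    ultimately show False by (simp add: nsets_def)
  qed
  have mgF: "multigraph F"
    unfolding multigraph_def
  proof (intro conjI ballI)
    show "finite (verts F)" "finite (edges F)" using fin by (simp_all add: F_def)
    fix j assume "j \<in> edges F"
    then obtain e where e: "e \<in> edges H" "j = g e" by (auto simp: F_def)
    obtain u v where "u \<in> verts H" "v \<in> verts H" "ends H e = {u, v}"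
      using multigraph_endsE[OF mg e(1)] .
    then show "\<exists>u\<in>verts F. \<exists>v\<in>verts F. u \<noteq> v \<and> ends F j = {u, v}"
      using e endsF[OF e(1)] proper[OF e(1)] by (intro bexI[of _ "z u"] bexI[of _ "z v"]) (simp_all add: F_def)
  qed
  \<comment> \<open>Identifying vertices may make differently placed coloured edges parallel. Since
    \<open>\<psi>\<close> is injective on its whole domain, the induced colouring of
    \<open>F\<close> is still a pre-colouring.\<close>
  have "inj_on \<psi>' (dom \<psi>')"
    unfolding dom' using inj\<psi> \<psi>'g by (auto simp: inj_on_def)
  moreover have "dom \<psi>' \<subseteq> edges F"
    using dom dom' by (auto simp: F_def)
  moreover have "ran \<psi>' \<subseteq> {1..k}"
    using ran by (force simp: ran_def \<psi>'_def split: if_splits)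
  ultimately have "precoloring_tuple k F \<psi>'"
    unfolding precoloring_tuple_def
    using mgF by (blast intro: inj_on_subset)
  moreover have between: "g ` edges_between H u v \<subseteq> edges_between F (z u) (z v)" for u v
    by (auto simp: F_def edges_between_def g')
  have "adjacent F (z u) (z v)" if adj: "adjacent H u v" for u v
  proof -
    obtain e where "e \<in> edges_between H u v" using adj by (auto simp: adjacent_def)
    then have "g e \<in> edges_between F (z u) (z v)" "z u \<noteq> z v"
      using between[of u v] proper[of e u v] by (auto simp: edges_between_def)
    then show ?thesis by (auto simp: adjacent_def)
  qed
  then have "color_hom H \<psi> F \<psi>' z g"
    unfolding color_hom_def
    using g dom' \<psi>'g between by (simp add: F_def)
  moreover have "bij_betw g (edges H) (edges F)"
    using g by (auto simp: bij_betw_def F_def)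
  ultimately have "(F, \<psi>') \<in> color_hom_images k H \<psi>"
    by (auto simp: color_hom_images_def color_hom_image_def)
  moreover have "rainbow_hom k V G F \<psi>' id (c \<circ> g')"
    using hom dom unfolding rainbow_hom_def dom'
    by (auto simp: F_def g' \<psi>'g inj_on_def subset_iff)
  ultimately show ?thesis using that[of F \<psi>' id "c \<circ> g'"] by simp
qed

text \<open>Every homomorphism factors through its own image, which is then embedded injectively;
  conversely a copy of an image composes with the map from \<open>H\<close>.\<close>

lemma color_hom_images_free_iff:
  fixes H :: "('v, 'e) multigraph" and G :: "nat \<Rightarrow> nat set set"
  assumes H: "rainbow_tuple k H \<psi>" and G: "graph_system k V G"
  shows "rainbow_family_free k V G (color_hom_images k H \<psi>) \<longleftrightarrow> \<not> (\<exists>z c. rainbow_hom k V G H \<psi> z c)"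
proof -
  have mg: "multigraph H" using H by (simp add: rainbow_tuple_def precoloring_tuple_def)
  have free: "rainbow_free k V G F \<psi>' \<longleftrightarrow> \<not> (\<exists>z c. rainbow_hom k V G F \<psi>' z c \<and> inj_on z (verts F))"
    if "(F, \<psi>') \<in> color_hom_images k H \<psi>" for F \<psi>'
  proof (rule rainbow_free_iff)
    show "multigraph F" "dom \<psi>' \<subseteq> edges F"
      using that by (simp_all add: color_hom_images_def precoloring_tuple_def)
  qed
  show ?thesis
  proof
    assume "rainbow_family_free k V G (color_hom_images k H \<psi>)"
    then have *: "rainbow_free k V G F \<psi>'" if "(F, \<psi>') \<in> color_hom_images k H \<psi>" for F \<psi>'
      using that unfolding rainbow_family_free_def by fast
    show "\<not> (\<exists>z c. rainbow_hom k V G H \<psi> z c)"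
    proof
      assume "\<exists>z c. rainbow_hom k V G H \<psi> z c"
      then obtain z c where "rainbow_hom k V G H \<psi> z c" by fast
      then obtain F \<psi>' z' c' where "(F, \<psi>') \<in> color_hom_images k H \<psi>"
        "rainbow_hom k V G F \<psi>' z' c'" "inj_on z' (verts F)"
        by (rule rainbow_hom_factor[OF H G])
      with *[of F \<psi>'] free[of F \<psi>'] show False by fast
    qed
  next
    assume *: "\<not> (\<exists>z c. rainbow_hom k V G H \<psi> z c)"
    show "rainbow_family_free k V G (color_hom_images k H \<psi>)"
      unfolding rainbow_family_free_def
    proof safe
      fix F \<psi>' assume F: "(F, \<psi>') \<in> color_hom_images k H \<psi>"
      then obtain f g where "color_hom H \<psi> F \<psi>' f g"
        by (auto simp: color_hom_images_def color_hom_image_def)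
      then show "rainbow_free k V G F \<psi>'"
        using free[OF F] * rainbow_hom_of_image[of k V G F \<psi>' _ _ H \<psi> f g, OF _ _ mg] by fast
    qed
  qed
qed

section \<open>Homomorphism probabilities under a random map\<close>

text \<open>The key case is an edge joining \<open>u\<close> to a vertex \<open>q\<close> with \<open>x q = x u\<close>: it is impossible, since
  its image under the given homomorphisms would be a singleton.\<close>

lemma rainbow_hom_split:
  assumes H: "multigraph H" and G: "graph_system k A G"
    and u: "u \<in> verts H" "w \<in> verts H" "u \<noteq> w" "x u = x w"
    and d: "d \<notin> x ` verts H" and st: "s \<in> A" "t \<in> A"
    and hs: "rainbow_hom k A G H \<psi> (y(x u := s) \<circ> x) c"
    and ht: "rainbow_hom k A G H \<psi> (y(x u := t) \<circ> x) c"
  shows "rainbow_hom k A G H \<psi> (y(x u := s, d := t) \<circ> x(u := d)) c"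
proof -
  let ?z = "y(x u := s, d := t) \<circ> x(u := d)"
  have z1: "?z p = (y(x u := s) \<circ> x) p" if "p \<in> verts H" "p \<noteq> u" for p
    using that d u(1) by auto
  have z2: "?z p = (y(x u := t) \<circ> x) p" if "p \<in> verts H" "p \<noteq> u" "x p \<noteq> x u" for p
    using that d u(1) by auto
  have key: "?z ` {u, q} \<in> G (c e)" if e: "e \<in> edges H" "ends H e = {u, q}" "q \<in> verts H" "q \<noteq> u" for e q
  proof (cases "x q = x u")
    case True
    then have "(y(x u := s) \<circ> x) ` ends H e = {s}" using e by auto
    moreover have "(y(x u := s) \<circ> x) ` ends H e \<in> nsets A 2"
      using hs G e(1) unfolding rainbow_hom_def graph_system_def by blast
    ultimately show ?thesis by (simp add: nsets_def)
  next
    case False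
    then have "?z ` {u, q} = (y(x u := t) \<circ> x) ` ends H e" using e z2[of q] by auto
    then show ?thesis using ht e(1) unfolding rainbow_hom_def by metis
  qed
  have "?z ` ends H e \<in> G (c e)" if e: "e \<in> edges H" for e
  proof -
    obtain p q where pq: "p \<in> verts H" "q \<in> verts H" "p \<noteq> q" "ends H e = {p, q}"
      using multigraph_endsE[OF H e] .
    consider "p = u" | "q = u" | "p \<noteq> u" "q \<noteq> u" by blast
    then show ?thesis
    proof cases
      case 1
      then show ?thesis using key[of e q] pq e by metis
    next
      case 2
      then show ?thesis using key[of e p] pq e by (metis insert_commute)
    next
      case 3
      then have "?z ` ends H e = (y(x u := s) \<circ> x) ` ends H e"
        using pq z1 by (metis image_insert image_empty)
      then show ?thesis using hs e unfolding rainbow_hom_def by metis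
    qed
  qed
  moreover have "?z \<in> verts H \<rightarrow> A"
  proof
    fix p assume p: "p \<in> verts H"
    show "?z p \<in> A"
    proof (cases "p = u")
      case False
      have "(y(x u := s) \<circ> x) p \<in> A" using hs p unfolding rainbow_hom_def by (blast dest: PiE)
      then show ?thesis by (simp only: z1[OF p False])
    qed (use st in simp)
  qed
  ultimately show ?thesis using hs unfolding rainbow_hom_def by blast
qed

text \<open>With all values of \<open>y\<close> except that at \<open>x u\<close> fixed,
  Cauchy-Schwarz bounds the squared probability by the probability that two independent values
  \<open>s\<close> and \<open>t\<close> both give homomorphisms. Then \<open>u\<close> can move to
  \<open>d\<close> with value \<open>t\<close>, while the other vertices over \<open>x u\<close>
  keep \<open>s\<close>.\<close>

lemma hom_probability_split:
  assumes I: "finite I" and A: "finite A" "A \<noteq> {}" and H: "multigraph H" and G: "graph_system k A G"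
    and u: "u \<in> verts H" "w \<in> verts H" "u \<noteq> w" "x u = x w"
    and x: "x \<in> verts H \<rightarrow> I" and d: "d \<in> I - x ` verts H"
  shows "(mean (I \<rightarrow>\<^sub>E A) (\<lambda>y. of_bool (rainbow_hom k A G H \<psi> (y \<circ> x) c)))\<^sup>2
    \<le> mean (I \<rightarrow>\<^sub>E A) (\<lambda>y. of_bool (rainbow_hom k A G H \<psi> (y \<circ> x(u := d)) c))"
proof -
  let ?W = "I \<rightarrow>\<^sub>E A" and ?h = "\<lambda>z. of_bool (rainbow_hom k A G H \<psi> z c) :: real"
  let ?b = "x u"
  have W: "finite ?W" "?W \<noteq> {}" using I A by (auto simp: finite_PiE PiE_eq_empty_iff)
  have b: "?b \<in> I" using x u by auto
  have "mean ?W (\<lambda>y. ?h (y \<circ> x)) = mean ?W (\<lambda>y. mean A (\<lambda>s. ?h (y(?b := s) \<circ> x)))"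
    by (rule mean_resample[OF I A b])
  then have "(mean ?W (\<lambda>y. ?h (y \<circ> x)))\<^sup>2 \<le> mean ?W (\<lambda>y. (mean A (\<lambda>s. ?h (y(?b := s) \<circ> x)))\<^sup>2)"
    by (simp only: mean_square[OF W])
  also have "\<dots> = mean ?W (\<lambda>y. mean A (\<lambda>s. mean A (\<lambda>t. ?h (y(?b := s) \<circ> x) * ?h (y(?b := t) \<circ> x))))"
    by (simp only: power2_eq_square mean_mult_left mean_mult_right)
  also have "\<dots> \<le> mean ?W (\<lambda>y. mean A (\<lambda>s. mean A (\<lambda>t. ?h (y(?b := s, d := t) \<circ> x(u := d)))))"
    using rainbow_hom_split[OF H G u] d
    by (intro mean_mono) (auto simp: of_bool_def)
  \<comment> \<open>Both resamplings are undone: \<open>t\<close> becomes the value at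
    \<open>d\<close> and \<open>s\<close> the value at \<open>x u\<close>, two distinct
    points.\<close>
  also have "\<dots> = mean ?W (\<lambda>y. ?h (y \<circ> x(u := d)))"
    using d mean_resample[OF I A, of d "\<lambda>y. ?h (y \<circ> x(u := d))"]
      mean_resample[OF I A b, of "\<lambda>y. mean A (\<lambda>t. ?h (y(d := t) \<circ> x(u := d)))"]
    by simp
  finally show ?thesis .
qed

lemma collision_probability:
  assumes I: "finite I" and A: "finite A" "A \<noteq> {}" and ab: "a \<in> I" "b \<in> I" "a \<noteq> b"
  shows "mean (I \<rightarrow>\<^sub>E A) (\<lambda>y. of_bool (y a = y b)) = 1 / real (card A)"
proof -
  have W: "finite (I \<rightarrow>\<^sub>E A)" "(I \<rightarrow>\<^sub>E A) \<noteq> {}" using I A by (auto simp: finite_PiE PiE_eq_empty_iff)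
  have "mean (I \<rightarrow>\<^sub>E A) (\<lambda>y. of_bool (y a = y b)) = mean (I \<rightarrow>\<^sub>E A) (\<lambda>y. mean A (\<lambda>s. of_bool (s = y b)))"
    using mean_resample[OF I A ab(1), of "\<lambda>y. of_bool (y a = y b)"] ab(3) by simp
  also have "\<dots> = mean (I \<rightarrow>\<^sub>E A) (\<lambda>y. 1 / real (card A))"
    using ab A by (intro mean_cong) (auto simp: mean_def of_bool_def)
  finally show ?thesis using W by (simp add: mean_const)
qed

text \<open>By \<open>noinj\<close>, a homomorphism \<open>y \<circ> x\<close> identifies two
  vertices. As \<open>x\<close> keeps them apart, \<open>y\<close> has a collision at two distinct
  points of \<open>I\<close>; take the union bound over ordered pairs of vertices.\<close>

lemma hom_probability_injective:
  assumes I: "finite I" and A: "finite A" "A \<noteq> {}" and V: "finite (verts H)"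
    and noinj: "\<And>z c. rainbow_hom k A G H \<psi> z c \<Longrightarrow> \<not> inj_on z (verts H)"
    and x: "x \<in> verts H \<rightarrow> I" "inj_on x (verts H)"
  shows "mean (I \<rightarrow>\<^sub>E A) (\<lambda>y. of_bool (rainbow_hom k A G H \<psi> (y \<circ> x) c)) \<le> (real (card (verts H)))\<^sup>2 / real (card A)"
proof -
  let ?W = "I \<rightarrow>\<^sub>E A"
  let ?D = "{p \<in> verts H \<times> verts H. fst p \<noteq> snd p}"
  let ?col = "\<lambda>p y. of_bool (y (x (fst p)) = y (x (snd p))) :: real"
  have finD: "finite ?D" using V by auto
  have "mean ?W (\<lambda>y. of_bool (rainbow_hom k A G H \<psi> (y \<circ> x) c)) \<le> mean ?W (\<lambda>y. \<Sum>p\<in>?D. ?col p y)"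
  proof (rule mean_mono)
    fix y
    show "of_bool (rainbow_hom k A G H \<psi> (y \<circ> x) c) \<le> (\<Sum>p\<in>?D. ?col p y)"
    proof (cases "rainbow_hom k A G H \<psi> (y \<circ> x) c")
      case True
      then obtain a b where "a \<in> verts H" "b \<in> verts H" "a \<noteq> b" "y (x a) = y (x b)"
        using noinj[OF True] by (auto simp: inj_on_def)
      then have p: "(a, b) \<in> ?D" "y (x (fst (a, b))) = y (x (snd (a, b)))"
        by simp_all
      from finD p(1) have "?col (a, b) y \<le> (\<Sum>p\<in>?D. ?col p y)"
        by (intro member_le_sum) simp_all
      with p show ?thesis by simp
    qed (simp add: sum_nonneg)
  qed
  also have "\<dots> = (\<Sum>p\<in>?D. 1 / real (card A))"
    unfolding mean_sum
  proof (rule sum.cong[OF refl])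
    fix p assume "p \<in> ?D"
    then have "x (fst p) \<in> I" "x (snd p) \<in> I" "x (fst p) \<noteq> x (snd p)"
      using x by (auto dest: inj_onD)
    then show "mean ?W (?col p) = 1 / real (card A)"
      by (rule collision_probability[OF I A])
  qed
  also have "\<dots> = real (card ?D) / real (card A)" by simp
  also have "\<dots> \<le> real (card (verts H \<times> verts H)) / real (card A)"
    using V by (intro divide_right_mono of_nat_mono card_mono) auto
  finally show ?thesis by (simp add: card_cartesian_product power2_eq_square)
qed

text \<open>Each split adds one point to the image of \<open>x\<close> at the cost of one squaring,
  until \<open>x\<close> is injective and the collision bound applies. The exponent is then weakened
  to one independent of \<open>x\<close>.\<close>

lemma hom_probability:
  assumes I: "finite I" "card (verts H) \<le> card I" and A: "finite A" "A \<noteq> {}"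
    and H: "multigraph H" and G: "graph_system k A G"
    and noinj: "\<And>z c. rainbow_hom k A G H \<psi> z c \<Longrightarrow> \<not> inj_on z (verts H)"
    and x: "x \<in> verts H \<rightarrow> I"
  shows "(mean (I \<rightarrow>\<^sub>E A) (\<lambda>y. of_bool (rainbow_hom k A G H \<psi> (y \<circ> x) c))) ^ (2 ^ card (verts H))
    \<le> (real (card (verts H)))\<^sup>2 / real (card A)"
proof -
  let ?p = "\<lambda>x. mean (I \<rightarrow>\<^sub>E A) (\<lambda>y. of_bool (rainbow_hom k A G H \<psi> (y \<circ> x) c))"
  let ?v = "card (verts H)"
  have V: "finite (verts H)" using H by (simp add: multigraph_def)
  have p01: "0 \<le> ?p x" "?p x \<le> 1" for x
    by (simp_all add: mean_nonneg mean_of_bool_le_1)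
  have "?p x ^ (2 ^ (?v - card (x ` verts H))) \<le> (real ?v)\<^sup>2 / real (card A)"
    using x
  proof (induction "?v - card (x ` verts H)" arbitrary: x)
    case 0
    then have "card (x ` verts H) = ?v" using card_image_le[OF V, of x] by simp
    then have "inj_on x (verts H)" using V eq_card_imp_inj_on by blast
    have "?p x \<le> (real ?v)\<^sup>2 / real (card A)"
      by (rule hom_probability_injective[OF I(1) A V _ 0(2) \<open>inj_on x (verts H)\<close>]) (rule noinj)
    then show ?case
      by (simp only: 0(1)[symmetric] power_0 power_one_right)
  next
    case (Suc j)
    then have less: "card (x ` verts H) < ?v" by simp
    then have "\<not> inj_on x (verts H)" using card_image by fastforce
    then obtain u w where u: "u \<in> verts H" "w \<in> verts H" "u \<noteq> w" "x u = x w"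
      unfolding inj_on_def by blast
    have sub: "x ` verts H \<subseteq> I" using Suc.prems by auto
    \<comment> \<open>A fresh point exists because the image has fewer than
      \<open>card (verts H) \<le> card I\<close> points.\<close>
    have "I - x ` verts H \<noteq> {}"
      using less I sub by (metis Diff_eq_empty_iff card_mono leD less_le_trans finite_subset)
    then obtain d where d: "d \<in> I - x ` verts H" by blast
    \<comment> \<open>Moving \<open>u\<close> loses no image point, since \<open>w\<close> still has
      the old value of \<open>u\<close>.\<close>
    have "x ` verts H \<subseteq> x(u := d) ` verts H"
    proof
      fix a assume "a \<in> x ` verts H"
      then obtain p where p: "p \<in> verts H" "a = x p" by blast
      show "a \<in> x(u := d) ` verts H"
      proof (cases "p = u")
        case True
        then show ?thesis using p u by (intro image_eqI[of _ _ w]) auto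
      next
        case False
        then show ?thesis using p by (intro image_eqI[of _ _ p]) auto
      qed
    qed
    then have "insert d (x ` verts H) = x(u := d) ` verts H"
      using u by auto
    then have "card (x(u := d) ` verts H) = Suc (card (x ` verts H))"
      using d V by (metis DiffD2 card_insert_disjoint finite_imageI)
    with Suc.hyps have j: "j = ?v - card (x(u := d) ` verts H)" by simp
    have "?p x ^ (2 ^ Suc j) = ((?p x)\<^sup>2) ^ (2 ^ j)"
      by (simp flip: power_mult add: mult.commute)
    also have "\<dots> \<le> ?p (x(u := d)) ^ (2 ^ j)"
      by (intro power_mono hom_probability_split[OF I(1) A H G u Suc.prems d]) simp
    also have "\<dots> \<le> (real ?v)\<^sup>2 / real (card A)"
    proof -
      have "x(u := d) \<in> verts H \<rightarrow> I" using Suc.prems d by auto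
      from Suc.hyps(1)[OF j this] show ?thesis by (simp only: j)
    qed
    finally show ?case using Suc.hyps(2) by simp
  qed
  \<comment> \<open>A number in [0, 1] only decreases when its exponent grows.\<close>
  moreover have "?p x ^ (2 ^ ?v) \<le> ?p x ^ (2 ^ (?v - card (x ` verts H)))"
    using p01 by (intro power_decreasing power_increasing) auto
  ultimately show ?thesis by linarith
qed

section \<open>Pullbacks of graph systems and their edge counts\<close>

text \<open>For a graph \<open>E\<close> this is its blow-up, in which each point is replaced by its
  fibre under \<open>y\<close>, an independent set.\<close>

definition pullback :: "'b set \<Rightarrow> ('b \<Rightarrow> 'a) \<Rightarrow> 'a set set \<Rightarrow> 'b set set" where
  "pullback I y E = {e \<in> nsets I 2. y ` e \<in> E}"

lemma rainbow_hom_pullback: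
  assumes "rainbow_hom k I (\<lambda>i. pullback I y (G i)) H \<psi> x c" and "y \<in> I \<rightarrow> A"
  shows "rainbow_hom k A G H \<psi> (y \<circ> x) c"
  using assms unfolding rainbow_hom_def pullback_def by (auto simp: Pi_def image_comp)

lemma card_pullback:
  assumes "finite I" "y \<in> I \<rightarrow> A" "E \<subseteq> nsets A 2"
  shows "(\<Sum>(a, b)\<in>{(a, b) \<in> I \<times> I. a \<noteq> b}. of_bool ({y a, y b} \<in> E)) = 2 * real (card (pullback I y E))"
proof -
  have "(\<Sum>(a, b)\<in>{(a, b) \<in> I \<times> I. a \<noteq> b}. of_bool ({y a, y b} \<in> E))
    = (\<Sum>(a, b)\<in>I \<times> I. of_bool ({a, b} \<in> pullback I y E) :: real)"
    using assms(1)
    by (intro sum.mono_neutral_cong_left)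
      (auto simp: pullback_def nsets_def card_insert_if split: if_splits)
  also have "\<dots> = (\<Sum>a\<in>I. \<Sum>b\<in>I. of_bool ({a, b} \<in> pullback I y E))"
    by (simp only: sum.cartesian_product)
  also have "\<dots> = 2 * real (card (pullback I y E))"
    using assms(1) by (rule sum_ordered_pairs) (auto simp: pullback_def)
  finally show ?thesis .
qed

lemma card_off_diagonal:
  assumes "finite I"
  shows "real (card {(a, b) \<in> I \<times> I. a \<noteq> b}) = real (card I) * (real (card I) - 1)"
proof -
  have "{(a, b) \<in> I \<times> I. a \<noteq> b} = I \<times> I - (\<lambda>a. (a, a)) ` I" by auto
  then have "card {(a, b) \<in> I \<times> I. a \<noteq> b} = card (I \<times> I) - card ((\<lambda>a. (a, a)) ` I)"
    using assms by (simp only:) (intro card_Diff_subset, auto)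
  also have "card ((\<lambda>a. (a, a)) ` I) = card I" by (intro card_image) (auto simp: inj_on_def)
  finally show ?thesis by (cases "card I") (auto simp: card_cartesian_product algebra_simps)
qed

text \<open>This is the second moment bound for the indicator of \<open>E\<close> minus its average
  \<open>p\<close> over all of \<open>A \<times> A\<close>. The diagonal is included in that average
  because the values of \<open>y\<close> at two points may coincide. The factor 2 comes from
  counting ordered pairs.\<close>

lemma edge_count_variance:
  assumes I: "finite I" and A: "finite A" "A \<noteq> {}" and E: "E \<subseteq> nsets A 2"
  shows "mean (I \<rightarrow>\<^sub>E A) (\<lambda>y. (2 * real (card (pullback I y E))
      - real (card I) * (real (card I) - 1) * (2 * real (card E) / (real (card A))\<^sup>2))\<^sup>2)
    \<le> 4 * real (card I) ^ 3"
proof -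
  let ?D = "{(a, b) \<in> I \<times> I. a \<noteq> b}" and ?n = "real (card A)"
  define p where "p = 2 * real (card E) / ?n\<^sup>2"
  have n: "?n > 0" using A by (simp add: card_gt_0_iff)
  have sum: "(\<Sum>s\<in>A. \<Sum>t\<in>A. of_bool ({s, t} \<in> E)) = p * ?n\<^sup>2"
    using n sum_ordered_pairs[OF A(1) E] by (simp add: p_def)
  have "(\<Sum>s\<in>A. \<Sum>t\<in>A. of_bool ({s, t} \<in> E)) \<le> (\<Sum>s\<in>A. \<Sum>t\<in>A. 1 :: real)"
    by (intro sum_mono) auto
  then have "p * ?n\<^sup>2 \<le> 1 * ?n\<^sup>2"
    unfolding sum by (simp add: power2_eq_square)
  then have p1: "p \<le> 1" using n by (simp add: mult_le_cancel_right)
  have p0: "p \<ge> 0" by (simp add: p_def)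
  have "mean (I \<rightarrow>\<^sub>E A) (\<lambda>y. (\<Sum>(a, b)\<in>?D. of_bool ({y a, y b} \<in> E) - p)\<^sup>2) \<le> 4 * real (card I) ^ 3"
  proof (rule mean_pair_square[OF I A])
    show "(\<Sum>s\<in>A. \<Sum>t\<in>A. of_bool ({s, t} \<in> E) - p) = 0"
      by (simp only: sum_subtractf sum) (simp add: power2_eq_square)
    show "\<bar>of_bool ({s, t} \<in> E) - p\<bar> \<le> 1" for s t
      using p0 p1 by (auto simp: of_bool_def)
  qed auto
  also have "mean (I \<rightarrow>\<^sub>E A) (\<lambda>y. (\<Sum>(a, b)\<in>?D. of_bool ({y a, y b} \<in> E) - p)\<^sup>2)
    = mean (I \<rightarrow>\<^sub>E A) (\<lambda>y. (2 * real (card (pullback I y E)) - real (card I) * (real (card I) - 1) * p)\<^sup>2)"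
  proof (rule mean_cong)
    fix y assume "y \<in> I \<rightarrow>\<^sub>E A"
    then have y: "y \<in> I \<rightarrow> A" by auto
    have "(\<Sum>(a, b)\<in>?D. of_bool ({y a, y b} \<in> E) - p) = 2 * real (card (pullback I y E)) - real (card ?D) * p"
      using card_pullback[OF I y E] by (simp add: case_prod_unfold sum_subtractf)
    then show "(\<Sum>(a, b)\<in>?D. of_bool ({y a, y b} \<in> E) - p)\<^sup>2
        = (2 * real (card (pullback I y E)) - real (card I) * (real (card I) - 1) * p)\<^sup>2"
      by (simp only: card_off_diagonal[OF I])
  qed
  finally show ?thesis by (simp only: p_def)
qed

text \<open>First moment method for all bad events at once: \<open>K\<close> counts the pairs of a
  colouring and a vertex map, \<open>\<eta>\<close> bounds the probability of each being a
  homomorphism, and Chebyshev's inequality with tolerance \<open>\<theta>\<close> handles the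
  \<open>k\<close> edge counts.\<close>

lemma good_sample:
  fixes k :: nat and H :: "('v, 'e) multigraph" and I :: "'b set" and A :: "'a set"
  defines "K \<equiv> real (card (edges H \<rightarrow>\<^sub>E {1..k})) * real (card (verts H \<rightarrow>\<^sub>E I))"
  assumes I: "finite I" "card (verts H) \<le> card I" and A: "finite A" "A \<noteq> {}"
    and H: "multigraph H" "dom \<psi> \<subseteq> edges H" and G: "graph_system k A G"
    and noinj: "\<And>z c. rainbow_hom k A G H \<psi> z c \<Longrightarrow> \<not> inj_on z (verts H)"
    and \<eta>: "0 \<le> \<eta>" "(real (card (verts H)))\<^sup>2 / real (card A) \<le> \<eta> ^ (2 ^ card (verts H))"
    and \<theta>: "0 < \<theta>" "K * \<eta> + real k * (4 * real (card I) ^ 3 / \<theta>\<^sup>2) < 1"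
  shows "\<exists>y \<in> I \<rightarrow> A. (\<forall>x c. \<not> rainbow_hom k I (\<lambda>i. pullback I y (G i)) H \<psi> x c) \<and>
    (\<forall>i\<in>{1..k}. real (card I) * (real (card I) - 1) * (2 * real (card (G i)) / (real (card A))\<^sup>2) - \<theta>
       < 2 * real (card (pullback I y (G i))))"
proof -
  let ?W = "I \<rightarrow>\<^sub>E A" and ?C = "edges H \<rightarrow>\<^sub>E {1..k}" and ?X = "verts H \<rightarrow>\<^sub>E I"
  let ?h = "\<lambda>x c y. of_bool (rainbow_hom k A G H \<psi> (y \<circ> x) c) :: real"
  let ?d = "\<lambda>i y. 2 * real (card (pullback I y (G i)))
    - real (card I) * (real (card I) - 1) * (2 * real (card (G i)) / (real (card A))\<^sup>2)"
  \<comment> \<open>Every bad event alone contributes at least 1 to \<open>?f\<close>, so a sample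
    with \<open>?f y < 1\<close> avoids all of them.\<close>
  let ?f = "\<lambda>y. (\<Sum>c\<in>?C. \<Sum>x\<in>?X. ?h x c y) + (\<Sum>i\<in>{1..k}. (?d i y)\<^sup>2 / \<theta>\<^sup>2)"
  have W: "finite ?W" "?W \<noteq> {}" using I A by (auto simp: finite_PiE PiE_eq_empty_iff)
  have fin: "finite (verts H)" "finite (edges H)" using H by (auto simp: multigraph_def)
  have finCX: "finite ?C" "finite ?X" using fin I by (auto intro!: finite_PiE)
  have hom: "mean ?W (?h x c) \<le> \<eta>" if "x \<in> ?X" for x c
  proof -
    have "mean ?W (?h x c) ^ (2 ^ card (verts H)) \<le> (real (card (verts H)))\<^sup>2 / real (card A)"
      using that by (intro hom_probability[OF I A H(1) G]) (auto dest: noinj)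
    also note \<eta>(2)
    finally have "mean ?W (?h x c) ^ (2 ^ card (verts H)) \<le> \<eta> ^ (2 ^ card (verts H))" .
    then show ?thesis using \<eta>(1) by (simp add: power_mono_iff mean_nonneg)
  qed
  have var: "mean ?W (\<lambda>y. (?d i y)\<^sup>2 / \<theta>\<^sup>2) \<le> 4 * real (card I) ^ 3 / \<theta>\<^sup>2" if "i \<in> {1..k}" for i
    unfolding mean_divide
    using edge_count_variance[OF I(1) A, of "G i"] that G \<theta>(1)
    by (intro divide_right_mono) (auto simp: graph_system_def)
  have "mean ?W ?f = (\<Sum>c\<in>?C. \<Sum>x\<in>?X. mean ?W (?h x c)) + (\<Sum>i\<in>{1..k}. mean ?W (\<lambda>y. (?d i y)\<^sup>2 / \<theta>\<^sup>2))"
    by (simp only: mean_add mean_sum)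
  also have "\<dots> \<le> (\<Sum>c\<in>?C. \<Sum>x\<in>?X. \<eta>) + (\<Sum>i\<in>{1..k}. 4 * real (card I) ^ 3 / \<theta>\<^sup>2)"
    by (intro add_mono sum_mono hom var)
  also have "\<dots> < 1" using \<theta>(2) by (simp add: K_def)
  finally obtain y where y: "y \<in> ?W" "?f y < 1"
    using mean_less_imp[OF W] by blast
  have yA: "y \<in> I \<rightarrow> A" using y(1) by auto
  have nonneg: "0 \<le> (\<Sum>c\<in>?C. \<Sum>x\<in>?X. ?h x c y)" "0 \<le> (\<Sum>i\<in>{1..k}. (?d i y)\<^sup>2 / \<theta>\<^sup>2)"
    by (simp_all add: sum_nonneg)
  have "\<not> rainbow_hom k I (\<lambda>i. pullback I y (G i)) H \<psi> x c" for x c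
  proof
    assume *: "rainbow_hom k I (\<lambda>i. pullback I y (G i)) H \<psi> x c"
    \<comment> \<open>Only extensional maps occur in the sums of \<open>?f\<close>, so the
      homomorphism is restricted before it is counted.\<close>
    let ?x = "restrict x (verts H)" and ?c = "restrict c (edges H)"
    have "rainbow_hom k I (\<lambda>i. pullback I y (G i)) H \<psi> ?x ?c"
      by (rule rainbow_hom_cong[OF H _ _ *]) auto
    then have "?h ?x ?c y = 1" using rainbow_hom_pullback yA by fastforce
    moreover have mem: "?x \<in> ?X" "?c \<in> ?C" using * by (auto simp: rainbow_hom_def)
    ultimately have "1 \<le> (\<Sum>x\<in>?X. ?h x ?c y)"
      using member_le_sum[OF mem(1), of "\<lambda>x. ?h x ?c y"] finCX by simp
    also have "\<dots> \<le> (\<Sum>c\<in>?C. \<Sum>x\<in>?X. ?h x c y)"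
      using member_le_sum[OF mem(2), of "\<lambda>c. \<Sum>x\<in>?X. ?h x c y"] finCX by (simp add: sum_nonneg)
    finally show False using y(2) nonneg by linarith
  qed
  moreover have "real (card I) * (real (card I) - 1) * (2 * real (card (G i)) / (real (card A))\<^sup>2) - \<theta>
      < 2 * real (card (pullback I y (G i)))" if "i \<in> {1..k}" for i
  proof -
    have "(?d i y)\<^sup>2 / \<theta>\<^sup>2 \<le> (\<Sum>i\<in>{1..k}. (?d i y)\<^sup>2 / \<theta>\<^sup>2)"
      using that by (intro member_le_sum) auto
    then have "(?d i y)\<^sup>2 / \<theta>\<^sup>2 < 1" using y(2) nonneg by linarith
    then have "(?d i y)\<^sup>2 < \<theta>\<^sup>2" using \<theta>(1) by simp
    then have "\<bar>?d i y\<bar> < \<theta>" using \<theta>(1) power2_less_imp_less[of "\<bar>?d i y\<bar>" \<theta>] by simp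
    then show ?thesis by linarith
  qed
  ultimately show ?thesis
    using yA by blast
qed

section \<open>Comparison of the extremal densities\<close>

definition free_sizes :: "nat \<Rightarrow> nat \<Rightarrow> (('v, 'e) multigraph \<times> ('e \<rightharpoonup> nat)) set \<Rightarrow> nat set" where
  "free_sizes k n \<F> = {Min ((\<lambda>i. card (G i)) ` {1..k}) | G.
     graph_system k {1..n} G \<and> rainbow_family_free k {1..n} G \<F>}"

lemma ex_star_eq: "ex_star k n \<F> = Sup (free_sizes k n \<F>)"
  by (simp add: ex_star_def free_sizes_def)

lemma free_sizes_le:
  assumes "k \<ge> 1" "s \<in> free_sizes k n \<F>"
  shows "s \<le> n choose 2"
proof -
  obtain G :: "nat \<Rightarrow> nat set set" where G: "graph_system k {1..n} G" "s = Min ((\<lambda>i. card (G i)) ` {1..k})"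
    using assms(2) by (auto simp: free_sizes_def)
  have "s \<le> card (G 1)" using assms(1) G(2) by (auto intro!: Min_le)
  also have "\<dots> \<le> card (nsets {1..n} 2)"
    using assms(1) G(1) by (intro card_mono) (auto simp: graph_system_def finite_imp_finite_nsets)
  finally show ?thesis by (simp add: card_nsets)
qed

lemma finite_free_sizes: "k \<ge> 1 \<Longrightarrow> finite (free_sizes k n \<F>)"
  using free_sizes_le by (metis finite_nat_set_iff_bounded_le)

lemma ex_star_upper: "k \<ge> 1 \<Longrightarrow> s \<in> free_sizes k n \<F> \<Longrightarrow> s \<le> ex_star k n \<F>"
  unfolding ex_star_eq using finite_free_sizes by (intro cSup_upper bdd_above_finite)

lemma ex_star_mem: "k \<ge> 1 \<Longrightarrow> free_sizes k n \<F> \<noteq> {} \<Longrightarrow> ex_star k n \<F> \<in> free_sizes k n \<F>"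
  unfolding ex_star_eq using finite_free_sizes by (metis Max_in cSup_eq_Max)

lemma ex_star_empty: "free_sizes k n \<F> = {} \<Longrightarrow> ex_star k n \<F> = 0"
  by (simp add: ex_star_eq)

lemma ex_star_density_bounds:
  assumes "k \<ge> 1"
  shows "0 \<le> ex_star_density k \<F> n" "ex_star_density k \<F> n \<le> 1"
proof -
  have "ex_star k n \<F> \<le> n choose 2"
    using ex_star_mem[OF assms, of n \<F>] ex_star_empty[of k n \<F>] free_sizes_le[OF assms] by fastforce
  then show "ex_star_density k \<F> n \<le> 1"
    unfolding ex_star_density_def by (intro divide_le_eq_1[THEN iffD2]) auto
qed (simp add: ex_star_density_def)

lemma rainbow_family_free_singleton_iff:
  fixes H :: "('v, 'e) multigraph"
  assumes "rainbow_tuple k H \<psi>"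
  shows "rainbow_family_free k V G {(H, \<psi>)}
    \<longleftrightarrow> \<not> (\<exists>z c. rainbow_hom k V G H \<psi> z c \<and> inj_on z (verts H))"
  using rainbow_free_iff[of H \<psi> k V G] assms
  by (simp add: rainbow_family_free_def rainbow_tuple_def precoloring_tuple_def)

text \<open>A system without any homomorphism from \<open>(H, \<psi>)\<close> has in particular no
  injective one, so it also competes for the right-hand side.\<close>

lemma ex_star_density_images_le:
  assumes "k \<ge> 1" and H: "rainbow_tuple k H \<psi>"
  shows "ex_star_density k (color_hom_images k H \<psi>) n \<le> ex_star_density k {(H, \<psi>)} n"
proof -
  let ?C = "color_hom_images k H \<psi>"
  have sub: "free_sizes k n ?C \<subseteq> free_sizes k n {(H, \<psi>)}"
    unfolding free_sizes_def
    using color_hom_images_free_iff[OF H] rainbow_family_free_singleton_iff[OF H] by fast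
  have "ex_star k n ?C \<le> ex_star k n {(H, \<psi>)}"
  proof (cases "free_sizes k n ?C = {}")
    case False
    then show ?thesis using ex_star_mem ex_star_upper sub assms(1) by blast
  qed (simp add: ex_star_empty)
  then show ?thesis by (simp add: ex_star_density_def divide_right_mono)
qed

text \<open>An extremal system on \<open>n\<close> points is pulled back to \<open>m\<close> points
  by a good sample. The pullback avoids all images and loses at most \<open>\<epsilon>\<close> in
  density.\<close>

lemma ex_star_density_le_images:
  fixes H :: "('v, 'e) multigraph"
  assumes k: "k \<ge> 1" and H: "rainbow_tuple k H \<psi>" and \<epsilon>: "\<epsilon> > 0"
  shows "\<exists>M. \<forall>m\<ge>M. \<exists>N. \<forall>n\<ge>N.
    ex_star_density k {(H, \<psi>)} n \<le> ex_star_density k (color_hom_images k H \<psi>) m + \<epsilon>"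
proof -
  let ?C = "color_hom_images k H \<psi>" and ?v = "card (verts H)"
  \<comment> \<open>The three bounds give \<open>m \<le> 2 * (m - 1)\<close>, enough room in
    \<open>I\<close> for splitting vertices, and a total Chebyshev bound of at most 1/2.\<close>
  define M where "M = max 2 (max ?v (nat \<lceil>128 * real k / \<epsilon>\<^sup>2\<rceil> + 1))"
  have mg: "multigraph H" "dom \<psi> \<subseteq> edges H"
    using H by (auto simp: rainbow_tuple_def precoloring_tuple_def)
  show ?thesis
  proof (rule exI[of _ M], intro allI impI)
    fix m assume "m \<ge> M"
    then have m2: "m \<ge> 2" and mv: "m \<ge> ?v" and "real m > 128 * real k / \<epsilon>\<^sup>2"
      unfolding M_def by linarith+
    then have mk: "128 * real k < \<epsilon>\<^sup>2 * real m" using \<epsilon> by (simp add: field_simps)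
    define I where "I = {1..m}"
    define K where "K = real (card (edges H \<rightarrow>\<^sub>E {1..k})) * real (card (verts H \<rightarrow>\<^sub>E I))"
    \<comment> \<open>Chosen so that the homomorphisms contribute less than 1/2 in
      expectation.\<close>
    define \<eta> where "\<eta> = 1 / (2 * (K + 1))"
    \<comment> \<open>Half of the error \<open>\<epsilon>\<close>, scaled to the
      \<open>m * (m - 1)\<close> ordered pairs; the other half pays for the normalisation by
      \<open>n^2\<close>.\<close>
    define \<theta> where "\<theta> = real m * (real m - 1) * (\<epsilon> / 2)"
    have K0: "K \<ge> 0" by (simp add: K_def)
    have \<eta>: "\<eta> > 0" "K * \<eta> < 1 / 2" using K0 by (auto simp: \<eta>_def field_simps)
    have mm: "real m * (real m - 1) > 0" using m2 by simp
    have \<theta>0: "\<theta> > 0" using mm \<epsilon> by (simp add: \<theta>_def)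
    have \<theta>: "real k * (4 * real m ^ 3 / \<theta>\<^sup>2) \<le> 1 / 2"
    proof -
      have "real m \<le> 2 * (real m - 1)" using m2 by simp
      then have "(real m)\<^sup>2 \<le> (2 * (real m - 1))\<^sup>2" by (intro power_mono) auto
      then have "\<epsilon>\<^sup>2 * (real m)\<^sup>2 \<le> \<epsilon>\<^sup>2 * (4 * (real m - 1)\<^sup>2)"
        by (intro mult_left_mono) (simp_all only: power_mult_distrib zero_le_power2, simp)
      moreover have "128 * real k * real m \<le> \<epsilon>\<^sup>2 * (real m)\<^sup>2"
        using mult_right_mono[OF less_imp_le[OF mk], of "real m"] by (simp add: power2_eq_square)
      ultimately have "32 * real k * real m \<le> \<epsilon>\<^sup>2 * (real m - 1)\<^sup>2" by linarith
      then have "(32 * real k * real m) * (real m)\<^sup>2 \<le> (\<epsilon>\<^sup>2 * (real m - 1)\<^sup>2) * (real m)\<^sup>2"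
        by (intro mult_right_mono) auto
      then have "real k * (8 * real m ^ 3) \<le> \<theta>\<^sup>2"
        by (simp add: \<theta>_def power2_eq_square power3_eq_cube algebra_simps)
      then show ?thesis using \<theta>0 by (simp add: field_simps)
    qed
    \<comment> \<open>The second bound gives \<open>1 / n \<le> \<epsilon> / 2\<close>; the third
      makes the collision bound at most \<open>\<eta> ^ (2 ^ ?v)\<close>.\<close>
    define N where "N = max 2 (max (nat \<lceil>2 / \<epsilon>\<rceil>) (nat \<lceil>(real ?v)\<^sup>2 / \<eta> ^ (2 ^ ?v)\<rceil>))"
    show "\<exists>N. \<forall>n\<ge>N. ex_star_density k {(H, \<psi>)} n \<le> ex_star_density k ?C m + \<epsilon>"
    proof (intro exI[of _ N] allI impI)
      fix n assume "n \<ge> N"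
      then have n2: "n \<ge> 2" and n\<epsilon>: "2 / \<epsilon> \<le> real n" and n\<eta>: "(real ?v)\<^sup>2 / \<eta> ^ (2 ^ ?v) \<le> real n"
        unfolding N_def by linarith+
      let ?A = "{1..n}" and ?q = "ex_star_density k {(H, \<psi>)} n"
      show "?q \<le> ex_star_density k ?C m + \<epsilon>"
      proof (cases "free_sizes k n {(H, \<psi>)} = {}")
        case True
        then show ?thesis
          using \<epsilon> ex_star_density_bounds(1)[OF k, of ?C m] by (simp add: ex_star_density_def ex_star_empty)
      next
        case False
        then obtain G where G: "graph_system k ?A G" "rainbow_family_free k ?A G {(H, \<psi>)}"
          "ex_star k n {(H, \<psi>)} = Min ((\<lambda>i. card (G i)) ` {1..k})"
          using ex_star_mem[OF k] unfolding free_sizes_def by blast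
        have noinj: "\<not> inj_on z (verts H)" if "rainbow_hom k ?A G H \<psi> z c" for z c
          using that G(2) rainbow_family_free_singleton_iff[OF H] by blast
        have n\<eta>': "(real ?v)\<^sup>2 / real (card ?A) \<le> \<eta> ^ (2 ^ ?v)"
          using n\<eta> n2 \<eta>(1) by (simp add: field_simps)
        have small: "K * \<eta> + real k * (4 * real (card I) ^ 3 / \<theta>\<^sup>2) < 1"
          using \<eta>(2) \<theta> by (simp add: I_def)
        obtain y where y: "y \<in> I \<rightarrow> ?A"
          "\<And>x c. \<not> rainbow_hom k I (\<lambda>i. pullback I y (G i)) H \<psi> x c"
          "\<And>i. i \<in> {1..k} \<Longrightarrow> real m * (real m - 1) * (2 * real (card (G i)) / (real n)\<^sup>2) - \<theta>
             < 2 * real (card (pullback I y (G i)))"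
          using good_sample[of I H ?A \<psi> k G \<eta> \<theta>] mv n2 mg G(1) noinj \<eta>(1) n\<eta>' \<theta>0 small
          unfolding K_def by (auto simp: I_def)
        let ?P = "\<lambda>i. pullback I y (G i)"
        have sys: "graph_system k {1..m} ?P"
          by (auto simp: graph_system_def pullback_def I_def)
        have "rainbow_family_free k {1..m} ?P ?C"
          using y(2) color_hom_images_free_iff[OF H sys] by (simp add: I_def)
        with sys have ex: "Min ((\<lambda>i. card (?P i)) ` {1..k}) \<le> ex_star k m ?C"
          by (intro ex_star_upper[OF k]) (auto simp: free_sizes_def)
        obtain i where i: "i \<in> {1..k}" "Min ((\<lambda>i. card (?P i)) ` {1..k}) = card (?P i)"
          using k Min_in[of "(\<lambda>i. card (?P i)) ` {1..k}"] by (metis (no_types, lifting)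
            atLeastAtMost_iff empty_iff finite_atLeastAtMost finite_imageI imageE image_is_empty order_refl)
        have choose: "real (j choose 2) = real j * (real j - 1) / 2" if "j \<ge> 2" for j
          using that by (cases j) (simp_all add: choose_two field_simps real_of_nat_div)
        have "ex_star k n {(H, \<psi>)} \<le> card (G i)"
          unfolding G(3) using i(1) by (intro Min_le) auto
        moreover have "real (ex_star k n {(H, \<psi>)}) = ?q * (real n * (real n - 1) / 2)"
          using n2 choose[OF n2] by (simp add: ex_star_density_def)
        ultimately have "?q * (real n * (real n - 1)) \<le> 2 * real (card (G i))" by linarith
        then have "?q * (real n * (real n - 1)) / (real n)\<^sup>2 \<le> 2 * real (card (G i)) / (real n)\<^sup>2"
          by (intro divide_right_mono) auto
        \<comment> \<open>Sampling sees edges relative to \<open>n^2\<close> ordered pairs, the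
          density relative to \<open>n * (n - 1)\<close>; the difference is
          \<open>?q / n\<close>.\<close>
        moreover have "?q * (real n * (real n - 1)) / (real n)\<^sup>2 = ?q - ?q / real n"
          using n2 by (simp add: field_simps power2_eq_square)
        moreover have "?q / real n \<le> 1 / real n"
          using ex_star_density_bounds(2)[OF k] by (intro divide_right_mono) auto
        moreover have "1 / real n \<le> \<epsilon> / 2"
          using n\<epsilon> n2 \<epsilon> by (simp add: field_simps)
        ultimately have "?q - \<epsilon> / 2 \<le> 2 * real (card (G i)) / (real n)\<^sup>2" by linarith
        then have "real m * (real m - 1) * (?q - \<epsilon> / 2) \<le> real m * (real m - 1) * (2 * real (card (G i)) / (real n)\<^sup>2)"
          using mm by (intro mult_left_mono) auto
        with y(3)[OF i(1)] have "real m * (real m - 1) * (?q - \<epsilon>) < 2 * real (card (?P i))"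
          by (simp add: \<theta>_def algebra_simps)
        also have "\<dots> \<le> 2 * real (ex_star k m ?C)" using ex i(2) by simp
        finally have "?q - \<epsilon> \<le> 2 * real (ex_star k m ?C) / (real m * (real m - 1))"
          using mm by (simp only: pos_le_divide_eq mult.commute[of "?q - \<epsilon>"] less_imp_le)
        also have "\<dots> = ex_star_density k ?C m"
          using m2 by (simp add: ex_star_density_def choose)
        finally show ?thesis by simp
      qed
    qed
  qed
qed

section \<open>Existence and equality of the limits\<close>

text \<open>Let \<open>L\<close> be the limit of a convergent subsequence of \<open>a\<close>.
  Letting \<open>n\<close> run along it bounds every late \<open>b m\<close> from below, and
  choosing \<open>m\<close> on it, where \<open>b m \<le> a m\<close> is close to \<open>L\<close>,
  bounds every late \<open>a n\<close> from above.\<close>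

lemma sandwiched_limit:
  fixes a b :: "nat \<Rightarrow> real"
  assumes a: "Bseq a" and ba: "\<And>n. b n \<le> a n"
    and ab: "\<And>\<epsilon>. \<epsilon> > 0 \<Longrightarrow> \<exists>M. \<forall>m\<ge>M. \<exists>N. \<forall>n\<ge>N. a n \<le> b m + \<epsilon>"
  obtains L where "a \<longlonglongrightarrow> L" "b \<longlonglongrightarrow> L"
proof -
  obtain r where r: "strict_mono r" "monoseq (\<lambda>j. a (r j))"
    using seq_monosub[of a] by auto
  then obtain L where L: "(\<lambda>j. a (r j)) \<longlonglongrightarrow> L"
    using Bseq_monoseq_convergent[of "\<lambda>j. a (r j)"] Bseq_subseq[OF a, of r]
    by (auto simp: convergent_def)
  have lower: "eventually (\<lambda>m. L - \<epsilon> \<le> b m) sequentially" if \<epsilon>: "\<epsilon> > 0" for \<epsilon>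
  proof -
    obtain M where M: "\<And>m. m \<ge> M \<Longrightarrow> \<exists>N. \<forall>n\<ge>N. a n \<le> b m + \<epsilon>" using ab[OF \<epsilon>] by blast
    have "L \<le> b m + \<epsilon>" if m: "m \<ge> M" for m
    proof -
      obtain N where N: "\<And>n. n \<ge> N \<Longrightarrow> a n \<le> b m + \<epsilon>" using M[OF m] by blast
      have "\<forall>j\<ge>N. a (r j) \<le> b m + \<epsilon>"
        using N r(1) seq_suble le_trans by blast
      then show ?thesis using L by (intro LIMSEQ_le_const2) auto
    qed
    then show ?thesis by (auto simp: eventually_sequentially algebra_simps intro!: exI[of _ M])
  qed
  have upper: "eventually (\<lambda>n. a n \<le> L + \<epsilon>) sequentially" if \<epsilon>: "\<epsilon> > 0" for \<epsilon>
  proof -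
    have "\<epsilon> / 2 > 0" using \<epsilon> by simp
    then obtain M where M: "\<And>m. m \<ge> M \<Longrightarrow> \<exists>N. \<forall>n\<ge>N. a n \<le> b m + \<epsilon> / 2" using ab by blast
    have "eventually (\<lambda>j. a (r j) < L + \<epsilon> / 2) sequentially"
      using order_tendstoD(2)[OF L, of "L + \<epsilon> / 2"] \<epsilon> by simp
    moreover have "eventually (\<lambda>j. j \<ge> M) sequentially" by (rule eventually_ge_at_top)
    ultimately obtain j where j: "a (r j) < L + \<epsilon> / 2" "j \<ge> M"
      using eventually_happens'[OF _ eventually_conj] sequentially_bot by blast
    then have "r j \<ge> M" using r(1) seq_suble le_trans by blast
    then obtain N where "\<And>n. n \<ge> N \<Longrightarrow> a n \<le> b (r j) + \<epsilon> / 2" using M by blast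
    moreover have "b (r j) + \<epsilon> / 2 \<le> L + \<epsilon>" using ba[of "r j"] j(1) by linarith
    ultimately show ?thesis by (force simp: eventually_sequentially)
  qed
  have "eventually (\<lambda>n. \<bar>a n - L\<bar> < \<epsilon> \<and> \<bar>b n - L\<bar> < \<epsilon>) sequentially" if "\<epsilon> > 0" for \<epsilon>
  proof -
    have "\<epsilon> / 2 > 0" using that by simp
    from lower[OF this] upper[OF this] show ?thesis
    proof eventually_elim
      case (elim n)
      with ba[of n] that show ?case by (auto simp: abs_less_iff)
    qed
  qed
  then have "a \<longlonglongrightarrow> L" "b \<longlonglongrightarrow> L"
    unfolding tendsto_iff dist_real_def eventually_conj_iff by blast+
  then show ?thesis by (rule that)
qed

text \<open>Convergence is asserted explicitly because \<open>lim\<close> is also defined on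
  divergent sequences, where an equation between its values would carry no information.\<close>

theorem theorem4p7:
  fixes k :: nat and H :: "('v, 'e) multigraph" and \<psi> :: "'e \<rightharpoonup> nat"
  assumes "k \<ge> 1" and "rainbow_tuple k H \<psi>"
  shows "convergent (ex_star_density k {(H, \<psi>)}) \<and>
         convergent (ex_star_density k (color_hom_images k H \<psi>)) \<and>
         pi_star k {(H, \<psi>)} = pi_star k (color_hom_images k H \<psi>)"
proof -
  have "Bseq (ex_star_density k {(H, \<psi>)})"
    using ex_star_density_bounds[OF assms(1), of "{(H, \<psi>)}"] by (intro BseqI'[of _ 1]) auto
  then obtain L where "ex_star_density k {(H, \<psi>)} \<longlonglongrightarrow> L" "ex_star_density k (color_hom_images k H \<psi>) \<longlonglongrightarrow> L"
    by (rule sandwiched_limit[OF _ ex_star_density_images_le[OF assms] ex_star_density_le_images[OF assms]])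
  then show ?thesis
    by (auto simp: pi_star_def convergent_def dest: limI)
qed

end
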